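(* Let $C$ be an integer and let $n\ge N_C^{\mathrm{rk}}$. If $$A\subset\mathbb R_{>0},\qquad |A|=n,\qquad |\mathrm{FS}(A)|\le T_n+n+C+1,$$ then $A$ is commensurable.
   Context: For a finite set $A\subset\mathbb R_{>0}$, $\mathrm{FS}(A)=\{\sum_{a\in X}a:X\subseteq A\}$ (empty sum included), and $T_n=\binom{n+1}{2}$. A finite set of positive reals is commensurable if it is contained in $\lambda\mathbb Z_{>0}$ for some $\lambda>0$. Constants: for $E\in\mathbb Z_{\ge0}$, $I_E=\max\{2E+5,\ 1+\lfloor 33+8\sqrt{E+16}\rfloor\}$ (used with $E=1$). For an integer $C$, $$r_C=\max\Bigl(\{3\}\cup\bigl\{r\in\mathbb Z_{\ge4}:\tfrac{r^2-5r+2}{2}\le C\bigr\}\Bigr),\qquad s_C=\max\{4,r_C\},$$ $$D_C^{\mathrm{rk}}=\max\{0,C+s_C-1\},\qquad J_C^{\mathrm{rk}}=\max\{I_1,s_C\},\qquad N_C^{\mathrm{rk}}=J_C^{\mathrm{rk}}+D_C^{\mathrm{rk}}.$$ *)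

theory Defs
  imports Complex_Main
begin

definition FS :: "real set \<Rightarrow> real set" where
  "FS A = {\<Sum>a\<in>X. a | X. X \<subseteq> A}"

definition T :: "nat \<Rightarrow> nat" where
  "T n = (n + 1) choose 2"

definition commensurable :: "real set \<Rightarrow> bool" where
  "commensurable A \<longleftrightarrow> (\<exists>c>0. A \<subseteq> {c * real_of_int k | k. k > 0})"

text \<open>The constants are integer-valued, since \<open>C\<close> ranges over all integers.\<close>

definition I_const :: "nat \<Rightarrow> int" where
  "I_const E = max (2 * int E + 5) (1 + \<lfloor>33 + 8 * sqrt (real E + 16)\<rfloor>)"

definition r_const :: "int \<Rightarrow> int" where
  "r_const C = Max ({3} \<union>
     {r. r \<ge> 4 \<and> (real_of_int r ^ 2 - 5 * real_of_int r + 2) / 2 \<le> real_of_int C})"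

definition s_const :: "int \<Rightarrow> int" where
  "s_const C = max 4 (r_const C)"

definition D_rk :: "int \<Rightarrow> int" where
  "D_rk C = max 0 (C + s_const C - 1)"

definition J_rk :: "int \<Rightarrow> int" where
  "J_rk C = max (I_const 1) (s_const C)"

definition N_rk :: "int \<Rightarrow> int" where
  "N_rk C = J_rk C + D_rk C"

text \<open>The set in the definition of \<open>r_const\<close> is finite, so that \<open>Max\<close> is a genuine maximum.\<close>

lemma finite_r_const_set:
  "finite {r::int. r \<ge> 4 \<and> (real_of_int r ^ 2 - 5 * real_of_int r + 2) / 2 \<le> real_of_int C}"
proof (rule finite_subset)
  show "{r::int. r \<ge> 4 \<and> (real_of_int r ^ 2 - 5 * real_of_int r + 2) / 2 \<le> real_of_int C}
        \<subseteq> {4..2 * \<bar>C\<bar> + 5}"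
  proof safe
    fix r :: int
    assume r: "r \<ge> 4"
      and le: "(real_of_int r ^ 2 - 5 * real_of_int r + 2) / 2 \<le> real_of_int C"
    have "real_of_int (r ^ 2 - 5 * r + 2) \<le> real_of_int (2 * C)"
      using le by simp
    then have "r ^ 2 - 5 * r + 2 \<le> 2 * C"
      by (simp only: of_int_le_iff)
    then have *: "r * (r - 5) + 2 \<le> 2 * C"
      by (simp add: power2_eq_square algebra_simps)
    have "r \<le> 2 * \<bar>C\<bar> + 5"
    proof (cases "r \<le> 5")
      case False
      then have "r * 1 \<le> r * (r - 5)"
        by (intro mult_left_mono) auto
      with * show ?thesis by linarith
    qed auto
    with r show "r \<in> {4..2 * \<bar>C\<bar> + 5}" by simp
  qed
qed simp

end

theory Submission
  imports Defs
begin

text \<open>Since \<open>s_const C \<ge> 4\<close> and \<open>I_const 1 \<ge> 66\<close>, the hypotheses force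
  \<open>card (FS A) \<le> T n + 2 * n - 68\<close>, so it suffices that \<open>card (FS A) \<ge> T n + 2 * n - 67\<close>
  whenever \<open>A\<close> is not contained in a rational line. Flipping signs only translates \<open>FS A\<close>, so
  one may reorder the real line freely by an additive, lexicographic order: given \<open>x \<in> A\<close> take a
  \<open>\<rat>\<close>-linear \<open>q\<close> with \<open>q x = 1\<close> and compare \<open>r - q r * x\<close> first and \<open>q r\<close> second. Removing the
  largest element \<open>a\<close> destroys at least as many sums as there are elements of \<open>FS (A - {a})\<close>
  below \<open>a\<close>; these include 0 and the other elements of \<open>A\<close>, and two more if \<open>A\<close> meets
  three lines \<open>r - q r * x = \<plusminus>h\<close> with distinct nonzero \<open>\<bar>h\<bar>\<close>, which makes an induction
  on \<open>card A\<close> work. If \<open>A\<close> meets at most two and one of them in four points, this case applies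
  with an extreme point of that line as \<open>x\<close>; otherwise all but six elements are rational
  multiples of \<open>x\<close>, and their subset sums are all below \<open>a\<close>.\<close>

text \<open>The class is closed under changing the signs of single elements, and no such change
  merges two elements. The induction runs over it because every new choice of order needs new
  signs.\<close>

definition antisymmetric_set :: "real set \<Rightarrow> bool" where
  "antisymmetric_set A \<longleftrightarrow> finite A \<and> 0 \<notin> A \<and> (\<forall>a\<in>A. - a \<notin> A)"

text \<open>A linear functional over the rationals, kept real-valued so that it multiplies reals
  directly. The normalisation at \<open>x\<close> makes \<open>transversal q x\<close> a projection
  whose kernel is the line of rational multiples of \<open>x\<close>.\<close>

definition rational_coordinate :: "(real \<Rightarrow> real) \<Rightarrow> real \<Rightarrow> bool" where
  "rational_coordinate q x \<longleftrightarrow> Modules.additive q \<and> (\<forall>r. q r \<in> \<rat>) \<and>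
     (\<forall>c\<in>\<rat>. \<forall>r. q (c * r) = c * q r) \<and> q x = 1"

definition transversal :: "(real \<Rightarrow> real) \<Rightarrow> real \<Rightarrow> real \<Rightarrow> real" where
  "transversal q x r = r - q r * x"

text \<open>For \<open>p = transversal q x\<close> the pair \<open>(p, q)\<close> separates reals,
  so this is the positive cone of a total additive order. Identity and zero as \<open>p\<close> and
  \<open>q\<close> give the usual order.\<close>

definition lex_positive :: "(real \<Rightarrow> real) \<Rightarrow> (real \<Rightarrow> real) \<Rightarrow> real \<Rightarrow> bool" where
  "lex_positive p q r \<longleftrightarrow> p r > 0 \<or> p r = 0 \<and> q r > 0"

section \<open>Subset sums under removal of a largest element and under sign changes\<close>

lemma T_Suc: "T (Suc n) = T n + Suc n"
  by (simp add: T_def numeral_2_eq_2)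

lemma two_T: "2 * T n = n * (n + 1)"
  by (induction n) (simp_all add: T_Suc, simp add: T_def)

lemma finite_FS: "finite A \<Longrightarrow> finite (FS A)"
proof -
  assume "finite A"
  moreover have "FS A = sum (\<lambda>a. a) ` Pow A"
    by (auto simp: FS_def)
  ultimately show ?thesis by simp
qed

lemma sum_in_FS: "X \<subseteq> A \<Longrightarrow> \<Sum>X \<in> FS A"
  by (auto simp: FS_def)

lemma zero_in_FS: "0 \<in> FS A"
  using sum_in_FS[of "{}" A] by simp

lemma member_in_FS: "a \<in> A \<Longrightarrow> a \<in> FS A"
  using sum_in_FS[of "{a}" A] by simp

lemma add_in_FS: "a \<in> A \<Longrightarrow> b \<in> A \<Longrightarrow> a \<noteq> b \<Longrightarrow> a + b \<in> FS A"
  using sum_in_FS[of "{a, b}" A] by simp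

lemma FS_mono: "A \<subseteq> B \<Longrightarrow> FS A \<subseteq> FS B"
  by (auto simp: FS_def)

text \<open>Writing \<open>S\<close> for the sum of \<open>A - {a}\<close>, the sums \<open>S + a - z\<close> are new: they are
  lexicographically larger than \<open>S\<close>, the largest element of \<open>FS (A - {a})\<close>.\<close>

lemma card_FS_remove:
  assumes fin: "finite A" and p: "Modules.additive p" and q: "Modules.additive q"
    and pos: "\<And>b. b \<in> A \<Longrightarrow> lex_positive p q b"
    and a: "a \<in> A" and Z: "Z \<subseteq> FS (A - {a})"
    and below: "\<And>z. z \<in> Z \<Longrightarrow> p z < p a \<or> p z = p a \<and> q z < q a"
  shows "card (FS (A - {a})) + card Z \<le> card (FS A)"
proof -
  let ?A = "A - {a}"
  let ?S = "\<Sum>?A"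
  let ?N = "(\<lambda>z. ?S + a - z) ` Z"
  have "?N \<subseteq> FS A"
  proof safe
    fix z assume "z \<in> Z"
    then obtain X where X: "X \<subseteq> ?A" "z = \<Sum>X"
      using Z by (auto simp: FS_def)
    have "\<Sum>(A - X) = \<Sum>A - \<Sum>X"
      using X fin by (intro sum_diff) auto
    also have "\<Sum>A = ?S + a"
      using fin a by (simp add: sum.remove)
    finally show "?S + a - z \<in> FS A"
      using sum_in_FS[of "A - X" A] X by simp
  qed
  moreover have "?N \<inter> FS ?A = {}"
  proof -
    have False if z: "z \<in> Z" and Y: "Y \<subseteq> ?A" and eq: "?S + a - z = \<Sum>Y" for z Y
    proof -
      \<comment> \<open>A coincidence would give \<open>?W\<close> the lexicographically negative
        sum \<open>z - a\<close>, although all its elements are lexicographically positive.\<close>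
      let ?W = "?A - Y"
      have fW: "finite ?W" using fin by simp
      have W: "\<Sum>?W = z - a"
        using sum_diff[of ?A Y "\<lambda>x. x"] fin Y eq by simp
      have pW: "p (z - a) = (\<Sum>b\<in>?W. p b)"
        using additive.sum[OF p, of "\<lambda>b. b" ?W] W by simp
      have qW: "q (z - a) = (\<Sum>b\<in>?W. q b)"
        using additive.sum[OF q, of "\<lambda>b. b" ?W] W by simp
      have p0: "p b \<ge> 0" if "b \<in> ?W" for b
        using pos[of b] that by (auto simp: lex_positive_def)
      then have "(\<Sum>b\<in>?W. p b) \<ge> 0"
        by (rule sum_nonneg)
      then have "p z \<ge> p a"
        using pW additive.diff[OF p, of z a] by simp
      with below[OF z] have eqs: "p z = p a" "q z < q a"
        by auto
      then have "(\<Sum>b\<in>?W. p b) = 0"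
        using pW additive.diff[OF p, of z a] by simp
      then have "\<forall>b\<in>?W. p b = 0"
        using sum_nonneg_eq_0_iff[OF fW, of p] p0 by blast
      then have "q b \<ge> 0" if "b \<in> ?W" for b
        using pos[of b] that by (auto simp: lex_positive_def)
      then have "(\<Sum>b\<in>?W. q b) \<ge> 0"
        by (rule sum_nonneg)
      then show False
        using qW additive.diff[OF q, of z a] eqs by simp
    qed
    then show ?thesis
      by (fastforce simp: FS_def)
  qed
  moreover have "card ?N = card Z"
    by (intro card_image inj_onI) simp
  moreover have "FS ?A \<subseteq> FS A"
    by (rule FS_mono) auto
  moreover have "finite (FS A)"
    using fin by (rule finite_FS)
  ultimately show ?thesis
    using card_Un_disjoint[of "FS ?A" ?N] card_mono[of "FS A" "FS ?A \<union> ?N"]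
    by (metis Int_commute Un_least finite_subset)
qed

text \<open>Flipping the set \<open>N\<close> of elements outside \<open>P\<close> translates all
  subset sums by \<open>- \<Sum>N\<close>: the flipped copy of \<open>X\<close> corresponds to the
  symmetric difference of \<open>X\<close> and \<open>N\<close>.\<close>

lemma card_FS_sign_flip:
  fixes P :: "real \<Rightarrow> bool"
  assumes A: "antisymmetric_set A"
  defines "B \<equiv> (\<lambda>b. if P b then b else - b) ` A"
  shows "antisymmetric_set B" and "card B = card A" and "card (FS B) = card (FS A)"
proof -
  define f where "f = (\<lambda>b::real. if P b then b else - b)"
  define N where "N = {b\<in>A. \<not> P b}"
  have B: "B = f ` A" by (simp add: B_def f_def)
  have fin: "finite A" and fN: "finite N" using A by (auto simp: antisymmetric_set_def N_def)
  have inj: "inj_on f A"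
    using A by (auto simp: inj_on_def f_def antisymmetric_set_def split: if_splits)
  show "antisymmetric_set B"
    using A by (auto simp: antisymmetric_set_def B f_def)
  show "card B = card A"
    using inj by (simp add: B card_image)
  have flip: "\<Sum>(f ` X) + \<Sum>N = \<Sum>((X - N) \<union> (N - X))" if X: "X \<subseteq> A" for X
  proof -
    have fX: "finite X" using X fin finite_subset by blast
    have "\<Sum>(f ` X) = sum f X"
      using inj X by (subst sum.reindex) (auto intro: inj_on_subset)
    also have "\<dots> = sum f (X - N) + sum f (X \<inter> N)"
      using sum.Int_Diff[OF fX, of f N] by simp
    also have "sum f (X - N) = \<Sum>(X - N)"
      using X by (intro sum.cong) (auto simp: f_def N_def)
    also have "sum f (X \<inter> N) = (\<Sum>b\<in>X \<inter> N. - b)"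
      by (intro sum.cong) (auto simp: f_def N_def)
    also have "\<dots> = - \<Sum>(X \<inter> N)"
      by (rule sum_negf)
    finally have 1: "\<Sum>(f ` X) = \<Sum>(X - N) + - \<Sum>(X \<inter> N)" .
    have 2: "\<Sum>N = \<Sum>(X \<inter> N) + \<Sum>(N - X)"
      using sum.Int_Diff[OF fN, of "\<lambda>x. x" X] by (simp add: Int_commute)
    have 3: "\<Sum>((X - N) \<union> (N - X)) = \<Sum>(X - N) + \<Sum>(N - X)"
      using fX fN by (intro sum.union_disjoint) auto
    show ?thesis using 1 2 3 by simp
  qed
  have "(\<lambda>s. s + \<Sum>N) ` FS B = FS A"
  proof (intro equalityI subsetI)
    fix s assume "s \<in> (\<lambda>s. s + \<Sum>N) ` FS B"
    then obtain Y where "Y \<subseteq> f ` A" "s = \<Sum>Y + \<Sum>N"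
      by (auto simp: FS_def B)
    then obtain X where X: "X \<subseteq> A" "s = \<Sum>(f ` X) + \<Sum>N"
      by (metis subset_imageE)
    moreover have "(X - N) \<union> (N - X) \<subseteq> A"
      using X by (auto simp: N_def)
    ultimately show "s \<in> FS A"
      using flip[of X] sum_in_FS by simp
  next
    fix s assume "s \<in> FS A"
    then obtain Y where Y: "Y \<subseteq> A" "s = \<Sum>Y"
      by (auto simp: FS_def)
    \<comment> \<open>Symmetric difference with \<open>N\<close> is an involution, so this
      \<open>X\<close> leads back to \<open>Y\<close>.\<close>
    define X where "X = (Y - N) \<union> (N - Y)"
    have "X \<subseteq> A" "(X - N) \<union> (N - X) = Y"
      using Y by (auto simp: N_def X_def)
    then have "s = \<Sum>(f ` X) + \<Sum>N" "f ` X \<subseteq> B"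
      using flip[of X] Y by (auto simp: B)
    then show "s \<in> (\<lambda>s. s + \<Sum>N) ` FS B"
      using sum_in_FS[of "f ` X" B] by simp
  qed
  then show "card (FS B) = card (FS A)"
    using card_image[of "\<lambda>s. s + \<Sum>N" "FS B"] by (auto simp: inj_on_def)
qed

section \<open>The general lower bound for subset sums\<close>

lemma antisymmetric_subset: "antisymmetric_set A \<Longrightarrow> B \<subseteq> A \<Longrightarrow> antisymmetric_set B"
  by (auto simp: antisymmetric_set_def intro: finite_subset)

lemma antisymmetric_positive: "finite A \<Longrightarrow> A \<subseteq> {0<..} \<Longrightarrow> antisymmetric_set A"
  unfolding antisymmetric_set_def
  by (metis greaterThan_iff less_irrefl neg_0_less_iff_less not_less_iff_gr_or_eq subset_iff)

text \<open>Below the maximum lie 0 and the \<open>n\<close> other elements, so each removal costs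
  at least \<open>n + 1\<close> sums.\<close>

lemma card_FS_positive:
  assumes "finite A" "A \<subseteq> {0<..}"
  shows "T (card A) + 1 \<le> card (FS A)"
  using assms
proof (induction "card A" arbitrary: A)
  case 0
  then show ?case by (simp add: T_def FS_def)
next
  case (Suc n)
  define a where "a = Max A"
  have ne: "A \<noteq> {}" using Suc.hyps by auto
  have a: "a \<in> A" and max: "\<And>b. b \<in> A \<Longrightarrow> b \<le> a"
    using Suc.prems ne by (auto simp: a_def)
  define A' where "A' = A - {a}"
  have A': "finite A'" "card A' = n" "A' \<subseteq> {0<..}"
    using Suc a by (auto simp: A'_def)
  have "card (FS A') + card (insert 0 A') \<le> card (FS A)"
    unfolding A'_def
  proof (rule card_FS_remove[where p = "\<lambda>r. r" and q = "\<lambda>_. 0"])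
    show "insert 0 (A - {a}) \<subseteq> FS (A - {a})"
      by (auto intro: zero_in_FS member_in_FS)
    fix z assume "z \<in> insert 0 (A - {a})"
    then show "z < a \<or> z = a \<and> 0 < (0::real)"
      using a max[of z] Suc.prems by auto
  qed (use Suc.prems a in \<open>auto simp: additive_def lex_positive_def\<close>)
  moreover have "card (insert 0 A') = Suc n"
    using A' by (subst card_insert_disjoint) auto
  moreover have "T n + 1 \<le> card (FS A')"
    using Suc.hyps(1)[of A'] A' by simp
  ultimately show ?case
    using Suc.hyps(2) T_Suc[of n] by simp
qed

lemma card_FS_antisymmetric:
  assumes "antisymmetric_set A"
  shows "T (card A) + 1 \<le> card (FS A)"
proof -
  let ?B = "(\<lambda>b. if b > 0 then b else - b) ` A"
  have "finite ?B" "?B \<subseteq> {0<..}"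
    using assms by (auto simp: antisymmetric_set_def) (metis linorder_cases)
  then show ?thesis
    using card_FS_positive[of ?B] card_FS_sign_flip[OF assms, of "\<lambda>b. b > 0"] by simp
qed

section \<open>Rational coordinates and the lexicographic order\<close>

lemma ex_rational_coordinate:
  assumes "x \<noteq> 0"
  shows "\<exists>q. rational_coordinate q x"
proof -
  interpret vector_space_pair "\<lambda>c r. real_of_rat c * r" "(*) :: rat \<Rightarrow> rat \<Rightarrow> rat"
    by unfold_locales (auto simp: algebra_simps of_rat_add of_rat_mult)
  \<comment> \<open>Over the rationals \<open>{x}\<close> extends to a Hamel basis, so a functional
    with value 1 at \<open>x\<close> exists.\<close>
  have "vs1.independent {x}"
    using assms by simp
  then obtain g where g: "Vector_Spaces.linear (\<lambda>c r. real_of_rat c * r) (*) g" "g x = 1"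
    using linear_independent_extend[of "{x}" "\<lambda>_. 1"] by auto
  have "rational_coordinate (\<lambda>r. real_of_rat (g r)) x"
    using g linear_add[OF g(1)] linear_scale[OF g(1)]
    by (auto simp: rational_coordinate_def additive_def of_rat_add of_rat_mult elim!: Rats_cases)
  then show ?thesis by blast
qed

lemma
  assumes "rational_coordinate q x"
  shows additive_coordinate: "Modules.additive q"
    and additive_transversal: "Modules.additive (transversal q x)"
    and coordinate_base: "q x = 1"
    and transversal_base: "transversal q x x = 0"
    and transversal_scale: "c \<in> \<rat> \<Longrightarrow> transversal q x (c * r) = c * transversal q x r"
    and transversal_eq_0: "transversal q x r = 0 \<longleftrightarrow> (\<exists>c\<in>\<rat>. r = c * x)"
  using assms
  by (auto simp: rational_coordinate_def transversal_def additive_def algebra_simps)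

text \<open>Maximise \<open>p\<close> first, then \<open>q\<close> among the maximisers; joint
  injectivity makes the maximum strict.\<close>

lemma ex_lex_max:
  fixes p q :: "'a \<Rightarrow> real"
  assumes fin: "finite A" and ne: "A \<noteq> {}"
    and inj: "\<And>b c. p b = p c \<Longrightarrow> q b = q c \<Longrightarrow> b = c"
  obtains a where "a \<in> A" "\<And>b. b \<in> A \<Longrightarrow> b \<noteq> a \<Longrightarrow> p b < p a \<or> p b = p a \<and> q b < q a"
proof -
  have attained: "\<exists>c\<in>S. \<forall>b\<in>S. f b \<le> f c" if "finite S" "S \<noteq> {}" for S and f :: "'a \<Rightarrow> real"
  proof -
    have "Max (f ` S) \<in> f ` S"
      using that by simp
    then obtain c where "c \<in> S" "f c = Max (f ` S)"
      by auto
    then show ?thesis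
      using that by (metis Max_ge finite_imageI imageI)
  qed
  obtain c where c: "c \<in> A" "\<And>b. b \<in> A \<Longrightarrow> p b \<le> p c"
    using attained[OF fin ne, of p] by blast
  let ?L = "{b\<in>A. p b = p c}"
  have "finite ?L" "?L \<noteq> {}"
    using fin c by auto
  then obtain a where a: "a \<in> ?L" "\<And>b. b \<in> ?L \<Longrightarrow> q b \<le> q a"
    using attained[of ?L q] by blast
  show thesis
  proof (rule that)
    show "a \<in> A" using a by simp
    fix b assume "b \<in> A" "b \<noteq> a"
    then show "p b < p a \<or> p b = p a \<and> q b < q a"
      using c(2)[of b] a(1) a(2)[of b] inj[of b a] by fastforce
  qed
qed

lemma coordinates_eqD:
  "transversal q x b = transversal q x c \<Longrightarrow> q b = q c \<Longrightarrow> b = c"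
  by (simp add: transversal_def)

lemma obtain_lex_positive:
  assumes A: "antisymmetric_set A" and q: "rational_coordinate q x"
  obtains B where "antisymmetric_set B" "card B = card A" "card (FS B) = card (FS A)"
    "\<And>b. b \<in> B \<Longrightarrow> lex_positive (transversal q x) q b"
    "\<And>a. a \<in> A \<Longrightarrow> a \<in> B \<or> - a \<in> B"
proof -
  let ?p = "transversal q x"
  let ?P = "lex_positive ?p q"
  let ?B = "(\<lambda>b. if ?P b then b else - b) ` A"
  have "?P r \<or> ?P (- r)" if "r \<noteq> 0" for r
    using coordinates_eqD[of q x r 0] that
      additive.minus[OF additive_coordinate[OF q]] additive.minus[OF additive_transversal[OF q]]
      additive.zero[OF additive_coordinate[OF q]] additive.zero[OF additive_transversal[OF q]]
    by (auto simp: lex_positive_def not_less order.order_iff_strict)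
  then have "?P b" if "b \<in> ?B" for b
    using that A by (auto simp: antisymmetric_set_def) metis
  moreover have "a \<in> ?B \<or> - a \<in> ?B" if "a \<in> A" for a
    using that by auto
  ultimately show thesis
    using that card_FS_sign_flip[OF A, of ?P] by blast
qed

section \<open>Sets not contained in a rational line\<close>

definition rationally_collinear :: "real set \<Rightarrow> bool" where
  "rationally_collinear A \<longleftrightarrow> (\<exists>x. \<forall>a\<in>A. \<exists>c\<in>\<rat>. a = c * x)"

text \<open>Any nonzero member can replace the base of the line, since its own coefficient is
  nonzero and can be divided out.\<close>

lemma rationally_collinear_member:
  assumes "rationally_collinear A" "x \<in> A" "x \<noteq> 0" "a \<in> A"
  shows "\<exists>c\<in>\<rat>. a = c * x"
proof -
  obtain w where w: "\<forall>a\<in>A. \<exists>c\<in>\<rat>. a = c * w"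
    using assms by (auto simp: rationally_collinear_def)
  obtain c d where "c \<in> \<rat>" "d \<in> \<rat>" "x = c * w" "a = d * w"
    using w assms by meson
  then have "d / c \<in> \<rat>" "a = d / c * x"
    using assms(3) by auto
  then show ?thesis by blast
qed

text \<open>The two extra sums come from adding \<open>x\<close> to the top element of each of two non-maximal
  levels of \<open>transversal q x\<close>; the result stays on its level but leaves the set.\<close>

lemma three_levels_reduction:
  assumes A: "antisymmetric_set A" and q: "rational_coordinate q x" and x: "x \<in> A"
    and sub: "{a, b, c} \<subseteq> A"
    and nz: "transversal q x a \<noteq> 0" "transversal q x b \<noteq> 0" "transversal q x c \<noteq> 0"
    and dist: "distinct [\<bar>transversal q x a\<bar>, \<bar>transversal q x b\<bar>, \<bar>transversal q x c\<bar>]"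
  obtains A' where "antisymmetric_set A'" "\<not> rationally_collinear A'" "card A = Suc (card A')"
    "card (FS A') + card A + 2 \<le> card (FS A)"
proof -
  let ?p = "transversal q x"
  note addp = additive_transversal[OF q] and addq = additive_coordinate[OF q]
  obtain B where B: "antisymmetric_set B" "card B = card A" "card (FS B) = card (FS A)"
    and pos: "\<And>b. b \<in> B \<Longrightarrow> lex_positive ?p q b"
    and AB: "\<And>a. a \<in> A \<Longrightarrow> a \<in> B \<or> - a \<in> B"
    using obtain_lex_positive[OF A q] by blast
  have fin: "finite B" using B by (simp add: antisymmetric_set_def)
  have p0: "?p b \<ge> 0" if "b \<in> B" for b
    using pos[OF that] by (auto simp: lex_positive_def)
  \<comment> \<open>The coordinates of \<open>x\<close> are \<open>(0, 1)\<close>, so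
    \<open>x\<close> keeps its sign.\<close>
  have xB: "x \<in> B"
    using AB[OF x] pos[of "- x"] transversal_base[OF q] coordinate_base[OF q]
      additive.minus[OF addp, of x] additive.minus[OF addq, of x]
    by (auto simp: lex_positive_def)
  have lift: "\<exists>b'\<in>B. ?p b' = \<bar>?p b\<bar>" if "b \<in> A" for b
    using AB[OF that] p0[of b] p0[of "- b"] additive.minus[OF addp, of b] by fastforce
  obtain a' b' c' where abc: "a' \<in> B" "b' \<in> B" "c' \<in> B"
    "?p a' = \<bar>?p a\<bar>" "?p b' = \<bar>?p b\<bar>" "?p c' = \<bar>?p c\<bar>"
    using sub lift by (metis insert_subset)
  have "\<exists>u\<in>B. \<exists>v\<in>B. \<exists>w\<in>B. 0 < ?p u \<and> ?p u < ?p v \<and> ?p v < ?p w"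
  proof -
    have "0 < ?p a'" "0 < ?p b'" "0 < ?p c'" "?p a' \<noteq> ?p b'" "?p a' \<noteq> ?p c'" "?p b' \<noteq> ?p c'"
      using nz dist abc by auto
    then show ?thesis
      using abc(1-3) by (metis linorder_neqE)
  qed
  then obtain u0 v0 w where uvw: "u0 \<in> B" "v0 \<in> B" "w \<in> B"
    "0 < ?p u0" "?p u0 < ?p v0" "?p v0 < ?p w"
    by blast
  obtain m where m: "m \<in> B"
    and max: "\<And>b. b \<in> B \<Longrightarrow> b \<noteq> m \<Longrightarrow> ?p b < ?p m \<or> ?p b = ?p m \<and> q b < q m"
  proof (rule ex_lex_max[OF fin, of ?p q])
    show "B \<noteq> {}" using xB by auto
  qed (use coordinates_eqD in blast)+
  have wm: "?p w \<le> ?p m"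
    using max[of w] uvw by fastforce
  have level_top: "\<exists>u\<in>B. ?p u = ?p u' \<and> u + x \<notin> B" if u': "u' \<in> B" for u'
  proof -
    obtain u where u: "u \<in> {b\<in>B. ?p b = ?p u'}"
      and mx: "\<And>b. b \<in> {b\<in>B. ?p b = ?p u'} \<Longrightarrow> b \<noteq> u \<Longrightarrow>
        ?p b < ?p u \<or> ?p b = ?p u \<and> q b < q u"
    proof (rule ex_lex_max[of "{b\<in>B. ?p b = ?p u'}" ?p q])
      show "finite {b\<in>B. ?p b = ?p u'}" "{b\<in>B. ?p b = ?p u'} \<noteq> {}"
        using fin u' by auto
    qed (use coordinates_eqD in blast)+
    have "?p (u + x) = ?p u" "q (u + x) = q u + 1"
      using additive.add[OF addp] additive.add[OF addq] transversal_base[OF q]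
        coordinate_base[OF q] by simp_all
    then have "u + x \<notin> B"
      using mx[of "u + x"] u by force
    then show ?thesis using u by blast
  qed
  obtain u v where u: "u \<in> B" "?p u = ?p u0" "u + x \<notin> B" and v: "v \<in> B" "?p v = ?p v0" "v + x \<notin> B"
    using level_top uvw by meson
  have px: "?p (r + x) = ?p r" for r
    using additive.add[OF addp] transversal_base[OF q] by simp
  have ne: "u \<noteq> x" "v \<noteq> x" "u \<noteq> m" "v \<noteq> m" "x \<noteq> m" "u \<noteq> v"
    using u v uvw wm transversal_base[OF q] by auto
  have nz2: "u + x \<noteq> 0" "v + x \<noteq> 0"
    using px[of u] px[of v] u v uvw additive.zero[OF addp] by auto
  let ?B = "B - {m}"
  \<comment> \<open>The level of \<open>m\<close> is at least that of \<open>w\<close>, hence above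
    those of \<open>u\<close> and \<open>v\<close>. So both extra sums are below \<open>m\<close>
    and avoid it as a summand.\<close>
  let ?Z = "insert (u + x) (insert (v + x) (insert 0 ?B))"
  have "card (FS ?B) + card ?Z \<le> card (FS B)"
  proof (rule card_FS_remove[OF fin addp addq pos m])
    show "?Z \<subseteq> FS ?B"
    proof -
      have "u \<in> ?B" "v \<in> ?B" "x \<in> ?B"
        using u v xB ne by auto
      then have "u + x \<in> FS ?B" "v + x \<in> FS ?B"
        using ne by (simp_all only: add_in_FS not_False_eq_True)
      moreover have "?B \<subseteq> FS ?B"
        by (rule subsetI) (rule member_in_FS)
      ultimately show ?thesis
        by (simp only: insert_subset zero_in_FS)
    qed
    fix z assume "z \<in> ?Z"
    then consider "z = u + x" | "z = v + x" | "z = 0" | "z \<in> ?B" by blast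
    then show "?p z < ?p m \<or> ?p z = ?p m \<and> q z < q m"
    proof cases
      case 1 then show ?thesis using px[of u] u uvw wm by simp
    next
      case 2 then show ?thesis using px[of v] v uvw wm by simp
    next
      case 3 then show ?thesis using additive.zero[OF addp] uvw wm by simp
    next
      case 4 then show ?thesis using max by blast
    qed
  qed
  moreover have "card ?Z = card B + 2"
  proof -
    have "0 \<notin> B" using B by (simp add: antisymmetric_set_def)
    then have "card ?Z = Suc (Suc (Suc (card ?B)))"
      using fin u v ne nz2 by simp
    then show ?thesis using card_Suc_Diff1[OF fin m] by simp
  qed
  \<comment> \<open>Both \<open>x\<close> and \<open>u\<close> survive the removal, and
    \<open>u\<close> is off the line of \<open>x\<close>.\<close>
  moreover have "\<not> rationally_collinear ?B"
  proof
    assume "rationally_collinear ?B"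
    moreover have "x \<noteq> 0"
      using coordinate_base[OF q] additive.zero[OF addq] by auto
    ultimately have "\<exists>c\<in>\<rat>. u = c * x"
      using rationally_collinear_member[of ?B x u] u(1) xB ne by blast
    then have "?p u = 0"
      using transversal_eq_0[OF q] by blast
    then show False using u uvw by simp
  qed
  moreover have "antisymmetric_set ?B"
    using B antisymmetric_subset by blast
  ultimately show thesis
    using that[of ?B] B card_Suc_Diff1[OF fin m] by simp
qed

lemma three_distinct_members:
  assumes "3 \<le> card S"
  obtains a b c where "{a, b, c} \<subseteq> S" "distinct [a, b, c]"
proof -
  obtain S' where "S' \<subseteq> S" "card S' = 3"
    using obtain_subset_with_card_n[OF assms] by metis
  then show thesis
    using that by (auto simp: card_3_iff)
qed

text \<open>A reduction gaining \<open>card A + 2\<close> sums matches the growth of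
  \<open>T n + 2 * n\<close> exactly. The constant 67 lets the general bound \<open>T n + 1\<close>
  settle all sizes up to 34.\<close>

lemma card_FS_noncollinear:
  assumes "antisymmetric_set A" "\<not> rationally_collinear A"
  shows "T (card A) + 2 * card A \<le> card (FS A) + 67"
  using assms
proof (induction "card A" arbitrary: A rule: less_induct)
  case less
  note A = less.prems(1)
  have reduce: ?case
    if "antisymmetric_set A'" "\<not> rationally_collinear A'" "card A = Suc (card A')"
      "card (FS A') + card A + 2 \<le> card (FS A)" for A'
    using less.hyps[of A'] that T_Suc[of "card A'"] by simp
  show ?case
  proof (cases "card A \<le> 34")
    case True
    then show ?thesis using card_FS_antisymmetric[OF A] by simp
  next
    case False
    then obtain x where x: "x \<in> A" by fastforce
    have "x \<noteq> 0" using A x by (auto simp: antisymmetric_set_def)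
    then obtain q where q: "rational_coordinate q x"
      using ex_rational_coordinate by blast
    let ?p = "transversal q x"
    note addp = additive_transversal[OF q] and addq = additive_coordinate[OF q]
    obtain B where B: "antisymmetric_set B" "card B = card A" "card (FS B) = card (FS A)"
      and pos: "\<And>b. b \<in> B \<Longrightarrow> lex_positive ?p q b"
      and AB: "\<And>a. a \<in> A \<Longrightarrow> a \<in> B \<or> - a \<in> B"
      using obtain_lex_positive[OF A q] by blast
    have fin: "finite B" using B by (simp add: antisymmetric_set_def)
    have p0: "?p b \<ge> 0" if "b \<in> B" for b
      using pos[OF that] by (auto simp: lex_positive_def)
    have xB: "x \<in> B"
      using AB[OF x] pos[of "- x"] transversal_base[OF q] coordinate_base[OF q]
        additive.minus[OF addp, of x] additive.minus[OF addq, of x]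
      by (auto simp: lex_positive_def)
    define B0 where "B0 = {b\<in>B. ?p b = 0}"
    define L where "L = (\<lambda>h. {b\<in>B. ?p b = h})"
    \<comment> \<open>Four points on a level leave three beside its extreme point. In the last case
      at most \<open>2 * 3 = 6\<close> elements are off the line of \<open>x\<close>.\<close>
    consider (levels) "3 \<le> card (?p ` B - {0})" | (long) h where "h \<noteq> 0" "4 \<le> card (L h)"
      | (small) "card (?p ` B - {0}) \<le> 2" "\<And>h. h \<noteq> 0 \<Longrightarrow> card (L h) \<le> 3"
      by force
    then show ?thesis
    proof cases
      case levels
      then obtain h1 h2 h3 where h: "{h1, h2, h3} \<subseteq> ?p ` B - {0}" "distinct [h1, h2, h3]"
        by (rule three_distinct_members)
      then obtain a b c where "{a, b, c} \<subseteq> B" "h1 = ?p a" "h2 = ?p b" "h3 = ?p c"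
        by auto
      then show ?thesis
        using three_levels_reduction[OF B(1) q xB, of a b c] h p0 reduce B by force
    next
      case (long h)
      \<comment> \<open>Seen from the extreme element \<open>y\<close> of a long level, the other elements of that level
        differ from \<open>y\<close> by distinct positive multiples of \<open>x\<close>, so they lie on distinct levels.\<close>
      have fL: "finite (L h)" "L h \<noteq> {}"
        using fin long by (simp add: L_def) (use long in force)
      obtain y where y: "y \<in> L h"
        and min: "\<And>b. b \<in> L h \<Longrightarrow> b \<noteq> y \<Longrightarrow> ?p b < ?p y \<or> ?p b = ?p y \<and> - q b < - q y"
      \<comment> \<open>On one level \<open>?p\<close> is constant, so negating \<open>q\<close>
        selects the element with the smallest \<open>q\<close>.\<close>
      proof (rule ex_lex_max[OF fL, of ?p "\<lambda>r. - q r"])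
        show "b = c" if "?p b = ?p c" "- q b = - q c" for b c
          using that coordinates_eqD by simp
      qed blast
      have "3 \<le> card (L h - {y})"
        using long y fL by simp
      then obtain a b c where abc: "{a, b, c} \<subseteq> L h - {y}" "distinct [a, b, c]"
        by (rule three_distinct_members)
      have yB: "y \<in> B" "?p y = h" using y by (auto simp: L_def)
      then have "y \<noteq> 0" using B by (auto simp: antisymmetric_set_def)
      then obtain q' where q': "rational_coordinate q' y"
        using ex_rational_coordinate by blast
      let ?p' = "transversal q' y"
      have p'x: "?p' x \<noteq> 0"
      \<comment> \<open>If \<open>x\<close> were a multiple of \<open>y\<close>, the level
        \<open>h\<close> of \<open>y\<close> would be 0 like that of \<open>x\<close>.\<close>
      proof
        assume "?p' x = 0"
        then obtain c where c: "c \<in> \<rat>" "x = c * y"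
          using transversal_eq_0[OF q'] by auto
        then have "c * h = 0"
          using transversal_scale[OF q c(1), of y] transversal_base[OF q] yB by simp
        then show False using c long \<open>x \<noteq> 0\<close> by simp
      qed
      have p': "?p' z = (q z - q y) * ?p' x" and qz: "q z > q y" if z: "z \<in> L h - {y}" for z
      proof -
        have pz: "?p z = ?p y" using z yB by (simp add: L_def)
        show "q z > q y" using min[of z] z pz by auto
        have "z = y + (q z - q y) * x"
          using pz by (simp add: transversal_def algebra_simps)
        then have "?p' z = ?p' y + ?p' ((q z - q y) * x)"
          using additive.add[OF additive_transversal[OF q']] by metis
        moreover have "q z - q y \<in> \<rat>"
          using q by (auto simp: rational_coordinate_def)
        ultimately show "?p' z = (q z - q y) * ?p' x"
          using transversal_scale[OF q'] transversal_base[OF q'] by simp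
      qed
      have nz: "?p' z \<noteq> 0" if "z \<in> L h - {y}" for z
        using p'[OF that] qz[OF that] p'x by simp
      have neq: "\<bar>?p' z\<bar> \<noteq> \<bar>?p' z'\<bar>" if z: "z \<in> L h - {y}" "z' \<in> L h - {y}" "z \<noteq> z'" for z z'
      proof
        assume "\<bar>?p' z\<bar> = \<bar>?p' z'\<bar>"
        then have "q z = q z'"
          using p'[OF z(1)] p'[OF z(2)] qz[OF z(1)] qz[OF z(2)] p'x by (simp add: abs_mult)
        then show False
          using z coordinates_eqD[of q x z z'] by (auto simp: L_def)
      qed
      have "{a, b, c} \<subseteq> B"
        using abc by (auto simp: L_def)
      then show ?thesis
        using three_levels_reduction[OF B(1) q' yB(1), of a b c] nz neq abc reduce B
        by (metis distinct_length_2_or_more distinct_singleton insert_subset)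
    next
      case small
      have "B = B0 \<union> (\<Union>h\<in>?p ` B - {0}. L h)"
        by (auto simp: B0_def L_def)
      then have "card B \<le> card B0 + card (\<Union>h\<in>?p ` B - {0}. L h)"
        by (metis card_Un_le)
      also have "card (\<Union>h\<in>?p ` B - {0}. L h) \<le> (\<Sum>h\<in>?p ` B - {0}. card (L h))"
        using fin by (intro card_UN_le) auto
      also have "\<dots> \<le> card (?p ` B - {0}) * 3"
        using sum_bounded_above[of "?p ` B - {0}" "\<lambda>h. card (L h)" 3] small(2) by simp
      finally have m: "card A \<le> card B0 + 6"
        using small(1) B by simp
      obtain a where a: "a \<in> B"
        and max: "\<And>b. b \<in> B \<Longrightarrow> b \<noteq> a \<Longrightarrow> ?p b < ?p a \<or> ?p b = ?p a \<and> q b < q a"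
      proof (rule ex_lex_max[OF fin, of ?p q])
        show "B \<noteq> {}" using xB by auto
      qed (use coordinates_eqD in blast)+
      \<comment> \<open>A largest element on level 0 would force all of \<open>A\<close> onto the
        line of \<open>x\<close>.\<close>
      have pa: "?p a > 0"
      proof (rule ccontr)
        assume "\<not> ?p a > 0"
        then have "?p b = 0" if "b \<in> B" for b
          using max[OF that] p0[OF that] by force
        then have "?p b = 0" if "b \<in> A" for b
          using AB[OF that] additive.minus[OF addp, of b] by fastforce
        then show False
          using less.prems(2) transversal_eq_0[OF q] unfolding rationally_collinear_def by blast
      qed
      have pz: "?p z = 0" if z: "z \<in> FS B0" for z
      proof -
        obtain X where X: "X \<subseteq> B0" "z = \<Sum>X"
          using z by (auto simp: FS_def)
        then show ?thesis
          using additive.sum[OF addp, of "\<lambda>b. b" X] by (auto simp: B0_def intro!: sum.neutral)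
      qed
      \<comment> \<open>All of \<open>FS B0\<close> stays on level 0, so it lies below
        \<open>a\<close>: the loss is quadratic in \<open>card B0\<close>.\<close>
      have "card (FS (B - {a})) + card (FS B0) \<le> card (FS B)"
      proof (rule card_FS_remove[OF fin addp addq pos a])
        show "FS B0 \<subseteq> FS (B - {a})"
          using pa by (intro FS_mono) (auto simp: B0_def)
      qed (use pz pa in auto)
      moreover have "T (card (B - {a})) + 1 \<le> card (FS (B - {a}))"
        using B by (intro card_FS_antisymmetric) (auto intro: antisymmetric_subset)
      moreover have "T (card B0) + 1 \<le> card (FS B0)"
        using B by (intro card_FS_antisymmetric) (auto simp: B0_def intro: antisymmetric_subset)
      moreover have "card A = Suc (card (B - {a}))"
        using card_Suc_Diff1[OF fin a] B by simp
      \<comment> \<open>The increment of \<open>T n + 2 * n\<close> from the bound for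
        \<open>B - {a}\<close> is \<open>3 * card A\<close>, and \<open>card B0\<close> is at least
        \<open>35 - 6 = 29\<close>.\<close>
      moreover have "3 * card A \<le> T (card B0) + 68"
      proof -
        have "29 \<le> card B0" using m False by simp
        then have "29 * (card B0 + 1) \<le> 2 * T (card B0)"
          unfolding two_T by (intro mult_right_mono) auto
        then show ?thesis using m by simp
      qed
      ultimately show ?thesis
        using B T_Suc[of "card (B - {a})"] by simp
    qed
  qed
qed

section \<open>From rational lines to commensurability\<close>

lemma commensurable_if_collinear:
  assumes fin: "finite A" and pos: "A \<subseteq> {0<..}" and col: "rationally_collinear A"
  shows "commensurable A"
proof (cases "A = {}")
  case True
  then show ?thesis by (auto simp: commensurable_def intro: exI[of _ 1])
next
  case False
  then obtain x where x: "x \<in> A" "x > 0"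
    using pos by auto
  have "\<forall>a\<in>A. \<exists>c\<in>\<rat>. a = c * x"
    using rationally_collinear_member[OF col x(1)] x by auto
  \<comment> \<open>Denominators are cleared one element at a time; \<open>x / N\<close> then serves
    as the common unit.\<close>
  with fin have "\<exists>N::int. N > 0 \<and> (\<forall>a\<in>A. \<exists>k::int. a * of_int N = of_int k * x)"
  proof (induction A rule: finite_induct)
    case empty
    then show ?case by (auto intro: exI[of _ 1])
  next
    case (insert a A)
    then obtain N where N: "N > 0" "\<forall>a\<in>A. \<exists>k::int. a * of_int N = of_int k * x"
      by auto
    obtain c where c: "c \<in> \<rat>" "a = c * x" using insert.prems by auto
    obtain i d :: int where id: "d > 0" "c = of_int i / of_int d"
      using c(1) by (auto elim: Rats_cases')
    have "\<exists>k::int. b * of_int (N * d) = of_int k * x" if b: "b \<in> insert a A" for b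
    proof (cases "b = a")
      case True
      then have "b * of_int (N * d) = of_int (N * i) * x"
        using c id by simp
      then show ?thesis by blast
    next
      case False
      then obtain k :: int where "b * of_int N = of_int k * x"
        using N(2) b False by blast
      then have "b * of_int (N * d) = of_int (k * d) * x"
        by (simp add: algebra_simps)
      then show ?thesis by blast
    qed
    moreover have "N * d > 0" using N id by simp
    ultimately show ?case by blast
  qed
  then obtain N :: int where N: "N > 0" "\<forall>a\<in>A. \<exists>k::int. a * of_int N = of_int k * x"
    by blast
  have "\<exists>k::int. a = x / of_int N * of_int k \<and> k > 0" if a: "a \<in> A" for a
  proof -
    obtain k :: int where k: "a * of_int N = of_int k * x"
      using N a by blast
    have "a > 0" using pos a by auto
    then have "of_int k * x > 0"
      using k N by (metis mult_pos_pos of_int_0_less_iff)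
    then have "k > 0" using x by (simp add: zero_less_mult_iff)
    moreover have "a = x / of_int N * of_int k"
      using k N by (simp add: field_simps)
    ultimately show ?thesis by blast
  qed
  moreover have "x / of_int N > 0" using x N by simp
  ultimately show ?thesis
    unfolding commensurable_def by blast
qed

theorem theorem4p2:
  fixes C :: int and n :: nat and A :: "real set"
  assumes "int n \<ge> N_rk C"
    and "finite A"
    and "A \<subseteq> {0<..}"
    and "card A = n"
    and "int (card (FS A)) \<le> int (T n) + int n + C + 1"
  shows "commensurable A"
proof (rule ccontr)
  assume "\<not> commensurable A"
  then have "\<not> rationally_collinear A"
    using commensurable_if_collinear assms by blast
  then have lower: "T n + 2 * n \<le> card (FS A) + 67"
    using card_FS_noncollinear antisymmetric_positive assms by blast
  \<comment> \<open>This gives \<open>I_const 1\<close> at least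
    \<open>1 + 33 + 8 * 4 = 66\<close>.\<close>
  have "4 \<le> sqrt (17::real)"
    by (rule real_le_rsqrt) simp
  then have "65 \<le> \<lfloor>33 + 8 * sqrt (real 1 + 16)\<rfloor>"
    by (simp only: le_floor_iff) simp
  then have "66 \<le> I_const 1"
    unfolding I_const_def by linarith
  then have "66 \<le> J_rk C"
    by (simp add: J_rk_def)
  moreover have "C + 3 \<le> D_rk C"
    by (simp add: D_rk_def s_const_def)
  \<comment> \<open>The two bounds on \<open>card (FS A)\<close> give \<open>n \<le> C + 68\<close>,
    which this misses by one.\<close>
  ultimately have "C + 69 \<le> int n"
    using assms(1) by (simp add: N_rk_def)
  then show False
    using lower assms(5) by linarith
qed

end
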